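(* Let $s\ge 1$ and $n_1,\ldots,n_s\in\mathbb{N}$ (positive integers). Let $G=S_{n_1,\ldots,n_s}$ be the starlike graph with vertex set $\{g_0\}\sqcup B_1\sqcup\cdots\sqcup B_s$, where $B_k=\{g_1^k,\ldots,g_{n_k}^k\}$, whose edges are exactly $\{g_i^k,g_{i+1}^k\}$ for $1\le i\le n_k-1$ and $\{g_{n_k}^k,g_0\}$, for $k=1,\ldots,s$ (so each $B_k$ is a path attached to $g_0$ by its endpoint $g_{n_k}^k$). Then: \begin{enumerate} \item For every $\lambda\in\sigma^+(G)$, setting $t=\lambda^2$, either $t=\rho_t(n_1,\ldots,n_s)$, or there exist $k\neq l$, $1\le k,l\le s$, with $t=\rho_t(n_k-1)=\rho_t(n_l-1)$. \item Conversely, if $t>0$ is such that either $\rho_t(n_1,\ldots,n_s)=t$, or there exist $k\ne l$, $1\le k,l\le s$, with $\rho_t(n_k-1)=\rho_t(n_l-1)=t$, then $\sqrt{t}\in\sigma^+(G)$. \item The index of $G$ equals $\sqrt{t_{\max}}$, where $t_{\max}$ is the maximal root $t>0$ of the equation $\rho_t(n_1,\ldots,n_s)=t$. \item Let $r$ be the index of $G$ and $t=r^2$. Then the components $y_0=y(g_0)$, $y_m^k=y(g_m^k)$ of the principal eigenvector $y$ of $G$ are, up to a common nonzero multiplier, given by $$y_0=\sqrt{t},\qquad y_m^k=t^{(m-n_k)/2}\prod_{i=m}^{n_k}\rho_t(i),\quad m=1,\ldots,n_k,\ 1\le k\le s.$$ \end{enumerate}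
   Context: Graphs are simple and undirected. The spectrum $\sigma(G)$ of a graph $G$ is the spectrum of its adjacency matrix (a real symmetric matrix); $\sigma^+(G)=\{\lambda\in\sigma(G):\lambda>0\}$. The index of a connected graph $G$ is $\max\sigma(G)$; it is a simple eigenvalue whose eigenspace is spanned by a vector with all coordinates positive, called the principal eigenvector. For real $t>0$ define the function $\rho_t$ on nonnegative integers by $\rho_t(0)=0$ and $\rho_t(n+1)=t/(t-\rho_t(n))$, with the convention that if $\rho_t(n)=t$ then $\rho_t(n+1)=\infty$ and $\rho_t(n+2)=0$ (and the recursion continues from there). For a vector $(n_1,\ldots,n_s)$ of positive integers, $\rho_t(n_1,\ldots,n_s)=\sum_{i=1}^s\rho_t(n_i)$ (which is $\infty$, hence not equal to $t$, if some term is $\infty$). *)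

theory Defs
  imports
    "HOL-Library.Extended_Real"
    "Jordan_Normal_Form.Spectral_Radius"
    "Graph_Theory.Pair_Digraph"
begin

text \<open>A finite simple undirected graph is a \<open>pair_graph\<close>, i.e.\ a finite loop-free symmetric
  digraph without parallel arcs. Its adjacency matrix is taken with respect to an enumeration
  \<open>vs\<close> of its vertices (a distinct list whose set is \<open>pverts G\<close>). As this matrix is real and
  symmetric, its spectrum over the reals is the whole spectrum.\<close>

definition adjacency_matrix :: "'v pair_pre_digraph \<Rightarrow> 'v list \<Rightarrow> real mat" where
  "adjacency_matrix G vs =
     mat (length vs) (length vs) (\<lambda>(i, j). if (vs ! i, vs ! j) \<in> parcs G then 1 else 0)"

definition graph_spectrum :: "'v pair_pre_digraph \<Rightarrow> 'v list \<Rightarrow> real set" where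
  "graph_spectrum G vs = spectrum (adjacency_matrix G vs)"

definition positive_spectrum :: "'v pair_pre_digraph \<Rightarrow> 'v list \<Rightarrow> real set" where
  "positive_spectrum G vs = {l \<in> graph_spectrum G vs. l > 0}"

definition graph_index :: "'v pair_pre_digraph \<Rightarrow> 'v list \<Rightarrow> real" where
  "graph_index G vs = Max (graph_spectrum G vs)"

definition vec_of_labelling :: "'v list \<Rightarrow> ('v \<Rightarrow> real) \<Rightarrow> real vec" where
  "vec_of_labelling vs y = vec (length vs) (\<lambda>i. y (vs ! i))"

text \<open>Vectors indexed by the vertices are functions on the vertex type, of which only the values on
  the vertex set matter. A principal eigenvector is positive and spans the eigenspace of the index;
  it is determined up to a positive factor.\<close>

definition principal_eigenvector ::
  "'v pair_pre_digraph \<Rightarrow> 'v list \<Rightarrow> ('v \<Rightarrow> real) \<Rightarrow> bool" where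
  "principal_eigenvector G vs y \<longleftrightarrow>
     eigenvector (adjacency_matrix G vs) (vec_of_labelling vs y) (graph_index G vs) \<and>
     (\<forall>v \<in> pverts G. y v > 0) \<and>
     (\<forall>z. eigenvector (adjacency_matrix G vs) z (graph_index G vs) \<longrightarrow>
        (\<exists>c. z = c \<cdot>\<^sub>v vec_of_labelling vs y))"

text \<open>\<open>Branch k i\<close> is the \<open>i\<close>-th vertex of the \<open>k\<close>-th branch, counted from the free end;
  both indices start at 1.\<close>

datatype vertex = Center | Branch nat nat

definition starlike_edges :: "nat \<Rightarrow> (nat \<Rightarrow> nat) \<Rightarrow> vertex set set" where
  "starlike_edges s n =
     {{Branch k i, Branch k (i + 1)} | k i. 1 \<le> k \<and> k \<le> s \<and> 1 \<le> i \<and> i < n k} \<union>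
     {{Branch k (n k), Center} | k. 1 \<le> k \<and> k \<le> s}"

definition starlike :: "nat \<Rightarrow> (nat \<Rightarrow> nat) \<Rightarrow> vertex pair_pre_digraph" where
  "starlike s n =
     \<lparr> pverts = insert Center {Branch k i | k i. 1 \<le> k \<and> k \<le> s \<and> 1 \<le> i \<and> i \<le> n k},
       parcs = {(u, v). {u, v} \<in> starlike_edges s n} \<rparr>"

lemma finite_pverts_starlike: "finite (pverts (starlike s n))"
proof -
  have "{Branch k i | k i. 1 \<le> k \<and> k \<le> s \<and> 1 \<le> i \<and> i \<le> n k} =
      (\<Union>k\<in>{1..s}. Branch k ` {1..n k})"
    by auto
  then show ?thesis
    by (simp add: starlike_def)
qed

lemma pair_graph_starlike:
  assumes "\<And>k. 1 \<le> k \<Longrightarrow> k \<le> s \<Longrightarrow> n k \<ge> 1"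
  shows "pair_graph (starlike s n)"
proof -
  have wf: "u \<in> pverts (starlike s n)" "v \<in> pverts (starlike s n)" "u \<noteq> v"
    if "(u, v) \<in> parcs (starlike s n)" for u v
    using that assms unfolding starlike_def starlike_edges_def
    by (auto simp: doubleton_eq_iff)
  have sub: "parcs (starlike s n) \<subseteq> pverts (starlike s n) \<times> pverts (starlike s n)"
    using wf by auto
  have fin: "finite (parcs (starlike s n))"
    using finite_subset[OF sub] finite_pverts_starlike by simp
  have sym: "sym (parcs (starlike s n))"
    by (auto simp: sym_def starlike_def insert_commute)
  show ?thesis
    using wf fin finite_pverts_starlike sym
    by unfold_locales (auto simp: symmetric_def arcs_ends_def arc_to_ends_def)
qed

text \<open>For \<open>t > 0\<close> the values are real or \<open>\<infinity>\<close>, never \<open>-\<infinity>\<close>, so the sum below is \<open>\<infinity>\<close> as soon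
  as one of its terms is.\<close>

primrec rho :: "real \<Rightarrow> nat \<Rightarrow> ereal" where
  "rho t 0 = 0"
| "rho t (Suc m) =
     (if rho t m = ereal t then \<infinity>
      else if rho t m = \<infinity> then 0
      else ereal t / (ereal t - rho t m))"

definition rho_sum :: "real \<Rightarrow> nat \<Rightarrow> (nat \<Rightarrow> nat) \<Rightarrow> ereal" where
  "rho_sum t s n = (\<Sum>k = 1..s. rho t (n k))"

end

theory Submission
  imports Defs
begin

text \<open>Along a branch an eigenvector equation for \<open>\<lambda>\<close> is the three-term recurrence of the Chebyshev
  polynomials, indexed and scaled so that \<open>U\<^sub>m(2 cos x) = sin (m x) / sin x\<close> (\<open>path_sol\<close>), so an
  eigenvector equals \<open>c\<^sub>k U\<^sub>m(\<lambda>)\<close> at \<open>g\<^sub>m\<^sup>k\<close> and \<open>c\<^sub>k U\<^bsub>n\<^sub>k+1\<^esub>(\<lambda>)\<close> at the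
  centre, while \<open>\<rho>\<^sub>t(m) = \<lambda> U\<^sub>m(\<lambda>) / U\<^bsub>m+1\<^esub>(\<lambda>)\<close> for \<open>t = \<lambda>\<^sup>2\<close>. If the centre does not vanish, the
  equation there says \<open>t = \<Sum>\<^sub>k \<rho>\<^sub>t(n\<^sub>k)\<close>; if it does, at least two branches carry a nonzero vector that
  vanishes at the centre. The index is found without Perron--Frobenius: let \<open>N\<close> be the largest branch
  length. At \<open>\<lambda> = 2 cos (\<pi>/(N+2))\<close> the longest branch alone gives \<open>\<rho>\<^sub>t(N) = t\<close>, and at \<open>\<lambda> = s+1\<close>
  the sum is below \<open>t\<close>, so in between some \<open>\<lambda>\<close> has an eigenvector that is positive everywhere. Pairing
  it with the absolute value of any other eigenvector shows that its eigenvalue is the largest.\<close>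

section \<open>The recurrence along a path\<close>

text \<open>For m >= 1 this is the characteristic polynomial of the path on m - 1 vertices,
  evaluated at \<open>l\<close>. Index 0 stands for a phantom vertex with value 0 before the free
  end of a branch.\<close>

fun path_sol :: "real \<Rightarrow> nat \<Rightarrow> real" where
  "path_sol l 0 = 0"
| "path_sol l (Suc 0) = 1"
| "path_sol l (Suc (Suc m)) = l * path_sol l (Suc m) - path_sol l m"

lemma path_sol_not_both_zero: "path_sol l m \<noteq> 0 \<or> path_sol l (Suc m) \<noteq> 0"
  by (induction m) auto

lemma path_sol_unique:
  assumes "b 0 = 0"
    and "\<And>i. 1 \<le> i \<Longrightarrow> i \<le> N \<Longrightarrow> b (i - 1) + b (i + 1) = l * b i"
    and "i \<le> Suc N"
  shows "b i = b 1 * path_sol l i"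
  using assms(2,3)
proof (induction l i rule: path_sol.induct)
  case (3 l m)
  then have "b m = b 1 * path_sol l m" "b (Suc m) = b 1 * path_sol l (Suc m)"
    by auto
  moreover have "b m + b (Suc (Suc m)) = l * b (Suc m)"
    using "3.prems"(1)[of "Suc m"] "3.prems"(2) by simp
  ultimately show ?case
    by (simp add: algebra_simps)
qed (use assms(1) in auto)

lemma path_sol_cos: "path_sol (2 * cos x) m * sin x = sin (real m * x)"
proof (induction "2 * cos x" m rule: path_sol.induct)
  case (3 m)
  have "sin (real (Suc (Suc m)) * x) + sin (real m * x) = 2 * cos x * sin (real (Suc m) * x)"
  proof -
    have "real (Suc (Suc m)) * x = real (Suc m) * x + x" "real m * x = real (Suc m) * x - x"
      by (auto simp: algebra_simps)
    then show ?thesis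
      by (simp only: sin_add sin_diff) simp
  qed
  then show ?case
    using 3 by (simp add: algebra_simps)
qed auto

text \<open>A discrete Sturm comparison. The Casoratian \<open>path_sol a m * path_sol l (Suc m) -
  path_sol l m * path_sol a (Suc m)\<close> is 0 at m = 0, and each step adds \<open>l - a\<close>
  times a product of positive values. As it stays nonnegative, positivity passes from the solution
  for \<open>a\<close> to the one for \<open>l\<close>.\<close>

lemma path_sol_pos_mono:
  assumes "a \<le> l" "\<And>m. 1 \<le> m \<Longrightarrow> m \<le> M \<Longrightarrow> path_sol a m > 0" "1 \<le> m" "m \<le> M"
  shows "path_sol l m > 0"
proof -
  have "path_sol l m * path_sol a (Suc m) \<le> path_sol a m * path_sol l (Suc m) \<and> path_sol l (Suc m) > 0"
    if "Suc m \<le> M" for m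
    using that
  proof (induction m)
    case (Suc m)
    let ?u = "path_sol l" and ?v = "path_sol a"
    have IH: "?u m * ?v (Suc m) \<le> ?v m * ?u (Suc m)" "?u (Suc m) > 0"
      using Suc by auto
    have v: "?v (Suc m) > 0" "?v (Suc (Suc m)) > 0"
      using Suc.prems assms(2)[of "Suc m"] assms(2)[of "Suc (Suc m)"] by simp_all
    have "?v (Suc m) * ?u (Suc (Suc m)) - ?u (Suc m) * ?v (Suc (Suc m)) =
        (l - a) * (?u (Suc m) * ?v (Suc m)) + (?v m * ?u (Suc m) - ?u m * ?v (Suc m))"
      by (simp add: algebra_simps)
    also have "\<dots> \<ge> 0"
      using IH v assms(1) by simp
    finally have *: "?u (Suc m) * ?v (Suc (Suc m)) \<le> ?v (Suc m) * ?u (Suc (Suc m))"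
      by simp
    have "0 < ?u (Suc m) * ?v (Suc (Suc m))"
      using IH v by simp
    with * have "0 < ?v (Suc m) * ?u (Suc (Suc m))"
      by linarith
    then show ?case
      using * v by (simp add: zero_less_mult_iff)
  qed auto
  from this[of "m - 1"] show ?thesis
    using assms(3,4) by simp
qed

text \<open>For \<open>l \<ge> 2\<close> the increments of the recurrence cannot decrease. This
  later bounds the quotients of consecutive values by 1.\<close>

lemma path_sol_mono:
  assumes "l \<ge> 2"
  shows "0 \<le> path_sol l m \<and> path_sol l m \<le> path_sol l (Suc m)"
proof (induction m)
  case (Suc m)
  then have "2 * path_sol l (Suc m) \<le> l * path_sol l (Suc m)"
    using assms by (intro mult_right_mono) auto
  then show ?case
    using Suc by auto
qed auto

lemma continuous_on_path_sol [continuous_intros]: "continuous_on A (\<lambda>l. path_sol l m)"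
proof -
  have "continuous_on A (\<lambda>l. path_sol l m) \<and> continuous_on A (\<lambda>l. path_sol l (Suc m))"
    by (induction m) (auto intro!: continuous_intros)
  then show ?thesis ..
qed

section \<open>The function rho as a quotient of path solutions\<close>

text \<open>Inserting the quotient into the recursion for \<open>rho\<close> reproduces the
  three-term recurrence. The conventions at infinity match its zeros: the value t announces a
  vanishing next denominator, and a pole is followed by 0 because the vanishing denominator becomes
  the next numerator.\<close>

lemma rho_eq_path_sol:
  assumes "l > 0"
  shows "rho (l\<^sup>2) m = (if path_sol l (Suc m) = 0 then \<infinity>
    else ereal (l * path_sol l m / path_sol l (Suc m)))"
proof (induction m)
  case (Suc m)
  let ?u = "path_sol l"
  consider "?u (Suc m) = 0" | "?u (Suc m) \<noteq> 0" "?u (Suc (Suc m)) = 0"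
    | "?u (Suc m) \<noteq> 0" "?u (Suc (Suc m)) \<noteq> 0" by blast
  then show ?case
  proof cases
    case 1
    then show ?thesis
      using Suc path_sol_not_both_zero[of l m] by auto
  next
    case 2
    then have "l * ?u m / ?u (Suc m) = l\<^sup>2"
      by (simp add: field_simps power2_eq_square)
    then show ?thesis
      using Suc 2 by (simp del: path_sol.simps)
  next
    case 3
    have ne: "l * ?u m / ?u (Suc m) \<noteq> l\<^sup>2"
      using 3 assms by (auto simp: field_simps power2_eq_square)
    have "l\<^sup>2 / (l\<^sup>2 - l * ?u m / ?u (Suc m)) = l * ?u (Suc m) / ?u (Suc (Suc m))"
    proof -
      have "l\<^sup>2 - l * ?u m / ?u (Suc m) = l * ?u (Suc (Suc m)) / ?u (Suc m)"
        using 3 by (simp add: field_simps power2_eq_square)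
      then show ?thesis
        using assms by (simp add: power2_eq_square del: path_sol.simps)
    qed
    then show ?thesis
      using Suc 3 ne by (simp del: path_sol.simps)
  qed
qed auto

text \<open>Used with \<open>m = n k - 1\<close>: the right-hand side then says that branch k admits
  a nonzero solution vanishing at the centre.\<close>

lemma rho_eq_iff:
  assumes "l > 0"
  shows "rho (l\<^sup>2) m = ereal (l\<^sup>2) \<longleftrightarrow> path_sol l (Suc (Suc m)) = 0"
proof (cases "path_sol l (Suc m) = 0")
  case True
  then show ?thesis
    using assms path_sol_not_both_zero[of l m] by (simp add: rho_eq_path_sol)
next
  case False
  then have "l * path_sol l m / path_sol l (Suc m) = l\<^sup>2 \<longleftrightarrow> path_sol l (Suc (Suc m)) = 0"
    using assms by (auto simp: field_simps power2_eq_square)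
  then show ?thesis
    using assms False by (simp add: rho_eq_path_sol)
qed

text \<open>One factor \<open>l\<close> of \<open>l\<^sup>2\<close> cancels against the numerators.
  The nonvanishing clause excludes infinite terms, which real division by zero would silently count
  as 0.\<close>

lemma rho_sum_eq_iff:
  assumes "l > 0"
  shows "rho_sum (l\<^sup>2) s n = ereal (l\<^sup>2) \<longleftrightarrow>
    (\<forall>k\<in>{1..s}. path_sol l (Suc (n k)) \<noteq> 0) \<and>
    (\<Sum>k = 1..s. path_sol l (n k) / path_sol l (Suc (n k))) = l"
proof (cases "\<forall>k\<in>{1..s}. path_sol l (Suc (n k)) \<noteq> 0")
  case True
  have "rho_sum (l\<^sup>2) s n =
      (\<Sum>k = 1..s. ereal (l * (path_sol l (n k) / path_sol l (Suc (n k)))))"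
    unfolding rho_sum_def using True assms
    by (intro sum.cong refl) (auto simp: rho_eq_path_sol)
  also have "\<dots> = ereal (l * (\<Sum>k = 1..s. path_sol l (n k) / path_sol l (Suc (n k))))"
    by (simp add: sum_distrib_left)
  finally show ?thesis
    using True assms by (simp add: power2_eq_square)
next
  case False
  then have "\<exists>k\<in>{1..s}. rho (l\<^sup>2) (n k) = \<infinity>"
    using assms by (auto simp: rho_eq_path_sol)
  then have "rho_sum (l\<^sup>2) s n = \<infinity>"
    by (auto simp: rho_sum_def sum_Pinfty)
  then show ?thesis
    using False by auto
qed

text \<open>By \<open>rho_eq_path_sol\<close> each factor is \<open>l\<close> times a quotient of
  consecutive values, so the product telescopes.\<close>

lemma prod_rho_eq:
  assumes "l > 0" "m \<le> N" "\<And>i. i \<le> N \<Longrightarrow> path_sol l (Suc i) > 0"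
  shows "(\<Prod>i = m..N. rho (l\<^sup>2) i) = ereal (l ^ Suc (N - m) * path_sol l m / path_sol l (Suc N))"
  using assms(2,3)
proof (induction N rule: dec_induct)
  case base
  then show ?case
    using assms(1) by (auto simp: rho_eq_path_sol order_less_imp_not_eq2)
next
  case (step N)
  have "path_sol l (Suc (Suc N)) > 0" "path_sol l (Suc N) > 0"
    using step.prems[of "Suc N"] step.prems[of N] by simp_all
  moreover have "(\<Prod>i = m..N. rho (l\<^sup>2) i) =
      ereal (l ^ Suc (N - m) * path_sol l m / path_sol l (Suc N))"
    using step.IH step.prems by simp
  ultimately show ?case
    using step.hyps assms(1)
    by (simp add: rho_eq_path_sol Suc_diff_le order_less_imp_not_eq2 del: path_sol.simps)
qed

section \<open>Eigenvectors as labellings\<close>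

lemma vec_of_labelling_surj:
  assumes "distinct vs" "z \<in> carrier_vec (length vs)"
  obtains y where "z = vec_of_labelling vs y"
proof
  show "z = vec_of_labelling vs (\<lambda>v. z $ (THE i. i < length vs \<and> vs ! i = v))"
  proof (rule eq_vecI)
    fix i assume "i < dim_vec (vec_of_labelling vs (\<lambda>v. z $ (THE i. i < length vs \<and> vs ! i = v)))"
    then have i: "i < length vs"
      by (simp add: vec_of_labelling_def)
    then have "(THE j. j < length vs \<and> vs ! j = vs ! i) = i"
      using assms(1) by (auto simp: nth_eq_iff_index_eq)
    then show "z $ i = vec_of_labelling vs (\<lambda>v. z $ (THE i. i < length vs \<and> vs ! i = v)) $ i"
      using i by (simp add: vec_of_labelling_def)
  qed (use assms(2) in \<open>simp add: vec_of_labelling_def\<close>)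
qed

text \<open>Summing along the enumeration \<open>vs\<close> is summing over vertices, so from here
  on eigenvectors are handled by one equation per vertex.\<close>

lemma eigenvector_labelling_iff:
  assumes "distinct vs"
  shows "eigenvector (adjacency_matrix G vs) (vec_of_labelling vs y) l \<longleftrightarrow>
    (\<exists>v\<in>set vs. y v \<noteq> 0) \<and>
    (\<forall>v\<in>set vs. (\<Sum>u\<in>set vs. if (v, u) \<in> parcs G then y u else 0) = l * y v)"
proof -
  let ?A = "adjacency_matrix G vs" and ?z = "vec_of_labelling vs y"
  have mult: "(?A *\<^sub>v ?z) $ i = (\<Sum>u\<in>set vs. if (vs ! i, u) \<in> parcs G then y u else 0)"
    if "i < length vs" for i
  proof -
    have "(?A *\<^sub>v ?z) $ i =
        (\<Sum>j\<in>{..<length vs}. if (vs ! i, vs ! j) \<in> parcs G then y (vs ! j) else 0)"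
      using that
      by (auto simp: adjacency_matrix_def vec_of_labelling_def scalar_prod_def lessThan_atLeast0
          intro!: sum.cong)
    also have "\<dots> = (\<Sum>u\<in>set vs. if (vs ! i, u) \<in> parcs G then y u else 0)"
      by (rule sum.reindex_bij_betw[OF bij_betw_nth]) (use assms in auto)
    finally show ?thesis .
  qed
  have dim: "dim_row ?A = length vs" "dim_vec ?z = length vs"
    by (auto simp: adjacency_matrix_def vec_of_labelling_def)
  have z: "?z $ i = y (vs ! i)" if "i < length vs" for i
    using that by (simp add: vec_of_labelling_def)
  have "?z \<noteq> 0\<^sub>v (length vs) \<longleftrightarrow> (\<exists>v\<in>set vs. y v \<noteq> 0)"
    by (simp add: vec_eq_iff dim z Bex_def in_set_conv_nth) blast
  moreover have "?A *\<^sub>v ?z = l \<cdot>\<^sub>v ?z \<longleftrightarrow>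
      (\<forall>v\<in>set vs. (\<Sum>u\<in>set vs. if (v, u) \<in> parcs G then y u else 0) = l * y v)"
    by (simp add: vec_eq_iff dim z mult all_set_conv_all_nth del: index_mult_mat_vec)
  ultimately show ?thesis
    unfolding eigenvector_def using dim by (auto intro: carrier_vecI)
qed

lemma graph_spectrum_iff:
  assumes "distinct vs"
  shows "l \<in> graph_spectrum G vs \<longleftrightarrow>
    (\<exists>y. eigenvector (adjacency_matrix G vs) (vec_of_labelling vs y) l)"
proof -
  have "z \<in> carrier_vec (length vs)" if "eigenvector (adjacency_matrix G vs) z l" for z
    using that by (simp add: eigenvector_def adjacency_matrix_def)
  then have "\<exists>y. eigenvector (adjacency_matrix G vs) (vec_of_labelling vs y) l"
    if "eigenvector (adjacency_matrix G vs) z l" for z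
    using that vec_of_labelling_surj[OF assms, of z] by blast
  then show ?thesis
    unfolding graph_spectrum_def spectrum_def eigenvalue_def by auto
qed

text \<open>Let x be an eigenvector for \<mu>. Since the matrix A has nonnegative entries, \<mu> |x|
  is at most A |x| entrywise. Pairing with the positive y and moving the symmetric A over to y gives
  \<mu> (y, |x|) \<le> l (y, |x|), and (y, |x|) is positive.\<close>

lemma graph_index_eqI:
  assumes vs: "distinct vs" and sym: "sym (parcs G)"
    and ev: "eigenvector (adjacency_matrix G vs) (vec_of_labelling vs y) l"
    and pos: "\<And>v. v \<in> set vs \<Longrightarrow> y v > 0"
  shows "graph_index G vs = l"
proof -
  let ?a = "\<lambda>v u. if (v, u) \<in> parcs G then 1 else (0::real)"
  have le: "\<mu> \<le> l" if mu: "\<mu> \<in> graph_spectrum G vs" for \<mu>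
  proof -
    obtain x where "eigenvector (adjacency_matrix G vs) (vec_of_labelling vs x) \<mu>"
      using mu graph_spectrum_iff[OF vs] by blast
    then have x: "\<exists>v\<in>set vs. x v \<noteq> 0"
        "\<And>v. v \<in> set vs \<Longrightarrow> (\<Sum>u\<in>set vs. ?a v u * x u) = \<mu> * x v"
      unfolding eigenvector_labelling_iff[OF vs] by (auto simp: if_distrib if_distribR cong: if_cong)
    have y: "\<And>v. v \<in> set vs \<Longrightarrow> (\<Sum>u\<in>set vs. ?a v u * y u) = l * y v"
      using ev unfolding eigenvector_labelling_iff[OF vs]
      by (auto simp: if_distrib if_distribR cong: if_cong)
    have a: "?a v u = ?a u v" for u v
      using sym by (auto dest: symD)
    have "\<mu> * (\<Sum>v\<in>set vs. y v * \<bar>x v\<bar>) \<le> (\<Sum>v\<in>set vs. y v * (\<Sum>u\<in>set vs. ?a v u * \<bar>x u\<bar>))"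
      unfolding sum_distrib_left[of \<mu>]
    proof (rule sum_mono)
      fix v assume v: "v \<in> set vs"
      have "\<mu> * \<bar>x v\<bar> \<le> \<bar>\<mu> * x v\<bar>"
        by (simp add: abs_mult mult_right_mono)
      also have "\<dots> = \<bar>\<Sum>u\<in>set vs. ?a v u * x u\<bar>"
        using x(2)[OF v] by simp
      also have "\<dots> \<le> (\<Sum>u\<in>set vs. \<bar>?a v u * x u\<bar>)"
        by (rule sum_abs)
      also have "\<dots> = (\<Sum>u\<in>set vs. ?a v u * \<bar>x u\<bar>)"
        by (intro sum.cong) auto
      finally show "\<mu> * (y v * \<bar>x v\<bar>) \<le> y v * (\<Sum>u\<in>set vs. ?a v u * \<bar>x u\<bar>)"
        using pos[OF v] by (simp only: mult.left_commute[of \<mu>] mult_le_cancel_left_pos)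
    qed
    also have "\<dots> = (\<Sum>v\<in>set vs. \<Sum>u\<in>set vs. \<bar>x u\<bar> * (?a u v * y v))"
      unfolding sum_distrib_left using a by (intro sum.cong refl) (simp only: mult_ac)
    also have "\<dots> = (\<Sum>u\<in>set vs. \<Sum>v\<in>set vs. \<bar>x u\<bar> * (?a u v * y v))"
      by (rule sum.swap)
    also have "\<dots> = (\<Sum>u\<in>set vs. \<bar>x u\<bar> * (l * y u))"
      unfolding sum_distrib_left[symmetric] using y by (intro sum.cong refl) (simp only:)
    also have "\<dots> = l * (\<Sum>v\<in>set vs. y v * \<bar>x v\<bar>)"
      by (simp add: sum_distrib_left mult_ac)
    finally have *: "\<mu> * (\<Sum>v\<in>set vs. y v * \<bar>x v\<bar>) \<le> l * (\<Sum>v\<in>set vs. y v * \<bar>x v\<bar>)" .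
    obtain w where "w \<in> set vs" "x w \<noteq> 0"
      using x(1) by blast
    then have "(\<Sum>v\<in>set vs. y v * \<bar>x v\<bar>) > 0"
      using pos by (intro sum_pos2[of _ w]) (auto simp: less_imp_le)
    with * show ?thesis
      by simp
  qed
  have "finite (graph_spectrum G vs)"
    unfolding graph_spectrum_def
    by (rule card_finite_spectrum[of _ "length vs"]) (simp add: adjacency_matrix_def)
  then show ?thesis
    unfolding graph_index_def using ev le graph_spectrum_iff[OF vs] by (intro Max_eqI) auto
qed

section \<open>Starlike graphs\<close>

lemma starlike_neighbours_Center:
  assumes "\<forall>k\<in>{1..s}. n k \<ge> 1"
  shows "{u \<in> pverts (starlike s n). (Center, u) \<in> parcs (starlike s n)} =
    (\<lambda>k. Branch k (n k)) ` {1..s}"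
  using assms by (auto simp: starlike_def starlike_edges_def doubleton_eq_iff)

lemma starlike_neighbours_Branch:
  assumes "1 \<le> k" "k \<le> s" "1 \<le> m" "m \<le> n k"
  shows "{u \<in> pverts (starlike s n). (Branch k m, u) \<in> parcs (starlike s n)} =
    (if m = 1 then {} else {Branch k (m - 1)}) \<union>
    {if m < n k then Branch k (m + 1) else Center}"
proof (rule Set.set_eqI)
  fix u
  \<comment> \<open>Edges are listed from the end farther from the centre, so this one is found
    under index \<open>m - 1\<close>.\<close>
  have prev: "{Branch k m, Branch k (m - 1)} \<in> starlike_edges s n" if "m \<noteq> 1"
  proof -
    have "{Branch k (m - 1), Branch k (m - 1 + 1)} \<in> starlike_edges s n"
      unfolding starlike_edges_def using assms that by fastforce
    then show ?thesis
      using assms by (simp add: insert_commute)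
  qed
  have succ: "{Branch k m, if m < n k then Branch k (m + 1) else Center} \<in> starlike_edges s n"
    using assms by (auto simp: starlike_edges_def)
  have "u \<in> pverts (starlike s n) \<and> {Branch k m, u} \<in> starlike_edges s n \<longleftrightarrow>
      m \<noteq> 1 \<and> u = Branch k (m - 1) \<or> u = (if m < n k then Branch k (m + 1) else Center)"
    (is "?L \<longleftrightarrow> ?P \<or> ?N")
  proof
    assume ?L
    then show "?P \<or> ?N"
      using assms by (auto simp: starlike_def starlike_edges_def doubleton_eq_iff)
  next
    assume "?P \<or> ?N"
    then show ?L
    proof
      assume ?P
      moreover have "Branch k (m - 1) \<in> pverts (starlike s n)" if "m \<noteq> 1"
        using that assms by (auto simp: starlike_def)
      ultimately show ?L
        using prev by simp
    next
      assume ?N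
      moreover have "(if m < n k then Branch k (m + 1) else Center) \<in> pverts (starlike s n)"
        using assms by (simp add: starlike_def)
      ultimately show ?L
        using succ by (simp only: simp_thms)
    qed
  qed
  then show "u \<in> {u \<in> pverts (starlike s n). (Branch k m, u) \<in> parcs (starlike s n)} \<longleftrightarrow>
      u \<in> (if m = 1 then {} else {Branch k (m - 1)}) \<union>
        {if m < n k then Branch k (m + 1) else Center}"
    by (auto simp: starlike_def)
qed

text \<open>The equations on one branch are the recurrence started from the phantom value 0, which
  determines the labels up to the factor c; the centre is the entry after the last branch
  vertex.\<close>

lemma starlike_branch_equations_iff:
  assumes k: "1 \<le> k" "k \<le> s" and V: "V = pverts (starlike s n)"
  shows "(\<forall>m\<in>{1..n k}. (\<Sum>u\<in>V. if (Branch k m, u) \<in> parcs (starlike s n) then y u else 0)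
      = l * y (Branch k m)) \<longleftrightarrow>
    (\<exists>c. y Center = c * path_sol l (Suc (n k)) \<and>
      (\<forall>m\<in>{1..n k}. y (Branch k m) = c * path_sol l m))"
proof -
  \<comment> \<open>The phantom 0 at index 0 and the centre at index \<open>n k + 1\<close> give all
    vertices of the branch, including both ends, an equation of the same form.\<close>
  define b where
    "b i = (if i = 0 then 0 else if i \<le> n k then y (Branch k i) else y Center)" for i :: nat
  have "finite V"
    using V finite_pverts_starlike by simp
  then have sum: "(\<Sum>u\<in>V. if (Branch k m, u) \<in> parcs (starlike s n) then y u else 0) =
      b (m - 1) + b (m + 1)" if "m \<in> {1..n k}" for m
    using that k starlike_neighbours_Branch[of k s m n] V
    by (auto simp: b_def sum.inter_filter[symmetric])
  have "(\<forall>m\<in>{1..n k}. b (m - 1) + b (m + 1) = l * b m) \<longleftrightarrow>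
      (\<exists>c. \<forall>m\<in>{1..Suc (n k)}. b m = c * path_sol l m)"
  proof
    assume "\<forall>m\<in>{1..n k}. b (m - 1) + b (m + 1) = l * b m"
    then have "b m = b 1 * path_sol l m" if "m \<le> Suc (n k)" for m
      using that by (intro path_sol_unique[of b "n k"]) (simp add: b_def, auto)
    then show "\<exists>c. \<forall>m\<in>{1..Suc (n k)}. b m = c * path_sol l m"
      by (meson atLeastAtMost_iff)
  next
    assume "\<exists>c. \<forall>m\<in>{1..Suc (n k)}. b m = c * path_sol l m"
    then obtain c where c: "\<And>m. 1 \<le> m \<Longrightarrow> m \<le> Suc (n k) \<Longrightarrow> b m = c * path_sol l m"
      by (meson atLeastAtMost_iff)
    have c': "b m = c * path_sol l m" if "m \<le> Suc (n k)" for m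
      using that c[of m] by (cases m) (auto simp: b_def)
    show "\<forall>m\<in>{1..n k}. b (m - 1) + b (m + 1) = l * b m"
    proof
      fix m assume "m \<in> {1..n k}"
      then obtain j where "m = Suc j" "Suc j \<le> n k"
        by (cases m) auto
      then show "b (m - 1) + b (m + 1) = l * b m"
        using c'[of j] c'[of "Suc j"] c'[of "Suc (Suc j)"] by (simp add: algebra_simps)
    qed
  qed
  moreover have "(\<forall>m\<in>{1..Suc (n k)}. b m = c * path_sol l m) \<longleftrightarrow>
      y Center = c * path_sol l (Suc (n k)) \<and>
      (\<forall>m\<in>{1..n k}. y (Branch k m) = c * path_sol l m)" for c
    by (auto simp: b_def atLeastAtMostSuc_conv)
  moreover have "b m = y (Branch k m)" if "m \<in> {1..n k}" for m
    using that by (simp add: b_def)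
  ultimately show ?thesis
    using sum by simp
qed

text \<open>Each branch is solved separately; the branches interact only through their common value
  at the centre and the equation there.\<close>

lemma starlike_eigenvector_iff:
  assumes n: "\<forall>k\<in>{1..s}. n k \<ge> 1"
    and vs: "distinct vs" "set vs = pverts (starlike s n)"
  shows "eigenvector (adjacency_matrix (starlike s n) vs) (vec_of_labelling vs y) l \<longleftrightarrow>
    (\<exists>v\<in>set vs. y v \<noteq> 0) \<and>
    (\<Sum>k = 1..s. y (Branch k (n k))) = l * y Center \<and>
    (\<forall>k\<in>{1..s}. \<exists>c. y Center = c * path_sol l (Suc (n k)) \<and>
      (\<forall>m\<in>{1..n k}. y (Branch k m) = c * path_sol l m))"
proof -
  let ?eq = "\<lambda>v. (\<Sum>u\<in>set vs. if (v, u) \<in> parcs (starlike s n) then y u else 0) = l * y v"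
  have "(\<Sum>u\<in>set vs. if (Center, u) \<in> parcs (starlike s n) then y u else 0) =
      (\<Sum>k = 1..s. y (Branch k (n k)))"
    using starlike_neighbours_Center[OF n]
    by (simp add: vs sum.inter_filter[symmetric] finite_pverts_starlike sum.reindex inj_on_def)
  moreover have "(\<forall>v\<in>set vs. ?eq v) \<longleftrightarrow> ?eq Center \<and> (\<forall>k\<in>{1..s}. \<forall>m\<in>{1..n k}. ?eq (Branch k m))"
    unfolding vs by (auto simp: starlike_def)
  moreover have "(\<forall>m\<in>{1..n k}. ?eq (Branch k m)) \<longleftrightarrow>
      (\<exists>c. y Center = c * path_sol l (Suc (n k)) \<and>
        (\<forall>m\<in>{1..n k}. y (Branch k m) = c * path_sol l m))" if "k \<in> {1..s}" for k
    using that vs by (intro starlike_branch_equations_iff) auto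
  ultimately show ?thesis
    unfolding eigenvector_labelling_iff[OF vs(1)] by simp
qed

text \<open>A single nonzero coefficient makes the vector nonzero, since the free end of branch k
  carries \<open>c k * path_sol l 1 = c k\<close>. The centre value \<open>y0\<close> may be
  0.\<close>

lemma starlike_eigenvector_of_coefficients:
  assumes n: "\<forall>k\<in>{1..s}. n k \<ge> 1"
    and vs: "distinct vs" "set vs = pverts (starlike s n)"
    and c: "\<And>k. k \<in> {1..s} \<Longrightarrow> y0 = c k * path_sol l (Suc (n k))"
    and sum: "(\<Sum>k = 1..s. c k * path_sol l (n k)) = l * y0"
    and k: "k \<in> {1..s}" "c k \<noteq> 0"
  shows "eigenvector (adjacency_matrix (starlike s n) vs)
    (vec_of_labelling vs (case_vertex y0 (\<lambda>k m. c k * path_sol l m))) l"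
proof -
  have "Branch k 1 \<in> set vs"
    using n k by (auto simp: vs starlike_def)
  then have "\<exists>v\<in>set vs. case_vertex y0 (\<lambda>k m. c k * path_sol l m) v \<noteq> 0"
    using k by (intro bexI[of _ "Branch k 1"]) auto
  then show ?thesis
    using c sum by (auto simp: starlike_eigenvector_iff[OF n vs])
qed

text \<open>The two alternatives correspond to the centre value: if it is nonzero, dividing the
  centre equation by it gives the sum condition; if it is zero, the contributions of the branches
  must cancel at the centre, which takes at least two of them.\<close>

lemma starlike_spectrum_iff:
  assumes s: "s \<ge> 1" and n: "\<forall>k\<in>{1..s}. n k \<ge> 1"
    and vs: "distinct vs" "set vs = pverts (starlike s n)"
  shows "l \<in> graph_spectrum (starlike s n) vs \<longleftrightarrow>
    (\<forall>k\<in>{1..s}. path_sol l (Suc (n k)) \<noteq> 0) \<and>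
      (\<Sum>k = 1..s. path_sol l (n k) / path_sol l (Suc (n k))) = l \<or>
    (\<exists>k\<in>{1..s}. \<exists>j\<in>{1..s}. k \<noteq> j \<and> path_sol l (Suc (n k)) = 0 \<and> path_sol l (Suc (n j)) = 0)"
    (is "_ \<longleftrightarrow> ?root \<or> ?pair")
proof
  assume "l \<in> graph_spectrum (starlike s n) vs"
  then obtain y where nz: "\<exists>v\<in>set vs. y v \<noteq> 0"
    and ctr: "(\<Sum>k = 1..s. y (Branch k (n k))) = l * y Center"
    and "\<forall>k\<in>{1..s}. \<exists>c. y Center = c * path_sol l (Suc (n k)) \<and>
      (\<forall>m\<in>{1..n k}. y (Branch k m) = c * path_sol l m)"
    unfolding graph_spectrum_iff[OF vs(1)] starlike_eigenvector_iff[OF n vs] by blast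
  then obtain c where c: "\<And>k. k \<in> {1..s} \<Longrightarrow> y Center = c k * path_sol l (Suc (n k))"
    "\<And>k m. k \<in> {1..s} \<Longrightarrow> m \<in> {1..n k} \<Longrightarrow> y (Branch k m) = c k * path_sol l m"
    by metis
  have "(\<Sum>k = 1..s. c k * path_sol l (n k)) = (\<Sum>k = 1..s. y (Branch k (n k)))"
    using c(2) n by (intro sum.cong) auto
  then have sum: "(\<Sum>k = 1..s. c k * path_sol l (n k)) = l * y Center"
    using ctr by simp
  show "?root \<or> ?pair"
  proof (cases "y Center = 0")
    case False
    then have ne: "path_sol l (Suc (n k)) \<noteq> 0" if "k \<in> {1..s}" for k
      using c(1)[OF that] by auto
    then have "y Center * (\<Sum>k = 1..s. path_sol l (n k) / path_sol l (Suc (n k))) =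
        (\<Sum>k = 1..s. c k * path_sol l (n k))"
      unfolding sum_distrib_left using c(1) by (intro sum.cong) (auto simp: field_simps)
    with sum False have "(\<Sum>k = 1..s. path_sol l (n k) / path_sol l (Suc (n k))) = l"
      by simp
    with ne show ?thesis
      by blast
  next
    case True
    obtain k where k: "k \<in> {1..s}" "c k \<noteq> 0"
      using nz True c(2) by (auto simp: vs starlike_def)
    have k0: "path_sol l (Suc (n k)) = 0"
      using c(1)[OF k(1)] True k(2) by simp
    \<comment> \<open>Consecutive values never both vanish, so branch k contributes a nonzero term
      to a sum equal to 0, and another branch must compensate.\<close>
    have "\<exists>j\<in>{1..s} - {k}. c j * path_sol l (n j) \<noteq> 0"
    proof (rule ccontr)
      assume "\<not> ?thesis"
      then have "(\<Sum>j\<in>{1..s} - {k}. c j * path_sol l (n j)) = 0"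
        by (intro sum.neutral) blast
      then have "c k * path_sol l (n k) = 0"
        using sum True k(1) by (simp add: sum.remove[of _ k])
      then show False
        using k(2) k0 path_sol_not_both_zero[of l "n k"] by simp
    qed
    then obtain j where j: "j \<in> {1..s}" "j \<noteq> k" "c j \<noteq> 0"
      by (metis DiffE insertI1 mult_zero_left)
    then have "path_sol l (Suc (n j)) = 0"
      using c(1)[OF j(1)] True by simp
    with k j k0 show ?thesis
      by blast
  qed
next
  assume "?root \<or> ?pair"
  then show "l \<in> graph_spectrum (starlike s n) vs"
  proof
    assume r: ?root
    show ?thesis
      unfolding graph_spectrum_iff[OF vs(1)]
    proof (rule exI, rule starlike_eigenvector_of_coefficients[OF n vs])
      \<comment> \<open>Scaling the centre to 1 forces each coefficient to be the reciprocal of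
        \<open>path_sol l (Suc (n k))\<close>; branch 1 shows that the vector is nonzero.\<close>
      show "1 \<in> {1..s}" "1 / path_sol l (Suc (n 1)) \<noteq> 0"
        using r s by auto
    qed (use r in \<open>auto simp: divide_inverse mult.commute\<close>)
  next
    assume ?pair
    then obtain k j where kj: "k \<in> {1..s}" "j \<in> {1..s}" "k \<noteq> j"
      "path_sol l (Suc (n k)) = 0" "path_sol l (Suc (n j)) = 0"
      by blast
    \<comment> \<open>Cross weights: the contributions of k and j at the centre become opposite
      products and cancel, while all other branches are 0.\<close>
    define c where "c i = (if i = k then path_sol l (n j) else if i = j then - path_sol l (n k) else 0)"
      for i
    have "(\<Sum>i = 1..s. c i * path_sol l (n i)) = (\<Sum>i\<in>{k, j}. c i * path_sol l (n i))"
      using kj by (intro sum.mono_neutral_right) (auto simp: c_def)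
    then have "(\<Sum>i = 1..s. c i * path_sol l (n i)) = l * 0"
      using kj by (simp add: c_def)
    moreover have "c k \<noteq> 0"
      using kj path_sol_not_both_zero[of l "n j"] by (simp add: c_def)
    moreover have "0 = c i * path_sol l (Suc (n i))" if "i \<in> {1..s}" for i
      using kj by (simp add: c_def del: path_sol.simps)
    ultimately show ?thesis
      unfolding graph_spectrum_iff[OF vs(1)]
      using starlike_eigenvector_of_coefficients[OF n vs, of 0 c l k] kj(1) by blast
  qed
qed

section \<open>The largest eigenvalue and its positive eigenvector\<close>

lemma exists_positive_root:
  fixes s :: nat and n :: "nat \<Rightarrow> nat"
  assumes s: "s \<ge> 1" and n: "\<forall>k\<in>{1..s}. n k \<ge> 1"
  obtains l where "l > 0"
    "\<And>k m. k \<in> {1..s} \<Longrightarrow> m \<in> {1..Suc (n k)} \<Longrightarrow> path_sol l m > 0"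
    "(\<Sum>k = 1..s. path_sol l (n k) / path_sol l (Suc (n k))) = l"
proof -
  define N where "N = Max (n ` {1..s})"
  have "N \<in> n ` {1..s}"
    unfolding N_def using s by (intro Max_in) auto
  then obtain K where K: "K \<in> {1..s}" "n K = N"
    by blast
  have nN: "n k \<le> N" if "k \<in> {1..s}" for k
    unfolding N_def using that by (intro Max_ge) auto
  have N: "N \<ge> 1"
    using K n by auto
  \<comment> \<open>Chosen so that sin(m x) is positive for m = 1, ..., N + 1 and vanishes at m = N
    + 2. Then \<open>a\<close> is the index of the path formed by the longest branch and the
    centre.\<close>
  define x where "x = pi / real (N + 2)"
  define a where "a = 2 * cos x"
  have x: "0 < x" "x < pi / 2" "x < pi"
    unfolding x_def using N pi_gt_zero by (auto simp: field_simps add_pos_nonneg)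
  have sinx: "sin x > 0"
    using x by (intro sin_gt_zero)
  have a: "a > 0"
    unfolding a_def using x by (simp add: cos_gt_zero)
  have a2: "a \<le> 2"
    unfolding a_def by simp
  have posa: "path_sol a m > 0" if "1 \<le> m" "m \<le> Suc N" for m
  proof -
    have "real m < real (N + 2)"
      using that by simp
    then have "real m * x < pi"
      unfolding x_def by (simp add: pos_divide_less_eq mult.commute)
    then have "sin (real m * x) > 0"
      using that x by (intro sin_gt_zero) auto
    then show ?thesis
      using path_sol_cos[of x m] sinx by (metis a_def zero_less_mult_pos2)
  qed
  have "path_sol a (Suc (Suc N)) * sin x = sin (real (N + 2) * x)"
    using path_sol_cos[of x "Suc (Suc N)"] by (simp add: a_def del: path_sol.simps)
  also have "\<dots> = 0"
    by (simp add: x_def)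
  finally have "path_sol a N = a * path_sol a (Suc N)"
    using sinx by simp
  then have aN: "path_sol a N / path_sol a (Suc N) = a"
    using posa[of "Suc N"] by simp
  \<comment> \<open>The comparison lemma keeps all denominators positive to the right of
    \<open>a\<close>, which also gives the continuity needed for the intermediate value
    theorem.\<close>
  have pos: "path_sol l m > 0" if "a \<le> l" "k \<in> {1..s}" "m \<in> {1..Suc (n k)}" for l k m
    using path_sol_pos_mono[OF that(1), of "Suc N" m] posa that nN[OF that(2)] by auto
  define f where "f l = (\<Sum>k = 1..s. path_sol l (n k) / path_sol l (Suc (n k))) - l" for l
  \<comment> \<open>The longest branch alone contributes \<open>a\<close>, and the other quotients
    are nonnegative.\<close>
  have fa: "f a \<ge> 0"
  proof -
    have "path_sol a (n K) / path_sol a (Suc (n K)) \<le>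
        (\<Sum>k = 1..s. path_sol a (n k) / path_sol a (Suc (n k)))"
    proof (rule member_le_sum[OF K(1)])
      fix k assume "k \<in> {1..s} - {K}"
      then show "0 \<le> path_sol a (n k) / path_sol a (Suc (n k))"
        using pos[of a k "n k"] pos[of a k "Suc (n k)"] n by auto
    qed auto
    then show ?thesis
      using K aN by (simp add: f_def)
  qed
  have aL: "a \<le> real s + 1"
    using a2 s by simp
  \<comment> \<open>As s + 1 is at least 2, each of the s quotients is at most 1, so their sum is
    below s + 1.\<close>
  have fL: "f (real s + 1) \<le> 0"
  proof -
    have "(\<Sum>k = 1..s. path_sol (real s + 1) (n k) / path_sol (real s + 1) (Suc (n k)))
        \<le> (\<Sum>k = 1..s. 1)"
    proof (rule sum_mono)
      fix k assume "k \<in> {1..s}"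
      then show "path_sol (real s + 1) (n k) / path_sol (real s + 1) (Suc (n k)) \<le> 1"
        using pos[OF aL, of k "Suc (n k)"] path_sol_mono[of "real s + 1" "n k"] s
        by (auto simp del: path_sol.simps)
    qed
    then show ?thesis
      by (simp add: f_def)
  qed
  have "continuous_on {a..real s + 1} f"
    unfolding f_def
  proof (intro continuous_intros ballI)
    fix k l assume "k \<in> {1..s}" "l \<in> {a..real s + 1}"
    then show "path_sol l (Suc (n k)) \<noteq> 0"
      using pos[of l k "Suc (n k)"] by (auto simp del: path_sol.simps)
  qed
  then obtain l where "a \<le> l" "f l = 0"
    using IVT2'[of f "real s + 1" 0 a] fa fL aL by blast
  then show thesis
    using that[of l] pos[of l] a by (auto simp: f_def)
qed

text \<open>The root just found has a positive eigenvector, so it is the index by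
  \<open>graph_index_eqI\<close>. Its eigenspace is a line because no
  \<open>path_sol l (Suc (n k))\<close> vanishes: the value at the centre determines every
  coefficient.\<close>

lemma starlike_index:
  assumes s: "s \<ge> 1" and n: "\<forall>k\<in>{1..s}. n k \<ge> 1"
    and vs: "distinct vs" "set vs = pverts (starlike s n)"
  obtains y where "graph_index (starlike s n) vs > 0"
    "\<And>k m. k \<in> {1..s} \<Longrightarrow> m \<in> {1..Suc (n k)} \<Longrightarrow> path_sol (graph_index (starlike s n) vs) m > 0"
    "(\<Sum>k = 1..s. path_sol (graph_index (starlike s n) vs) (n k) /
      path_sol (graph_index (starlike s n) vs) (Suc (n k))) = graph_index (starlike s n) vs"
    "principal_eigenvector (starlike s n) vs y"
proof -
  let ?A = "adjacency_matrix (starlike s n) vs"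
  obtain l where l: "l > 0"
    and pos: "\<And>k m. k \<in> {1..s} \<Longrightarrow> m \<in> {1..Suc (n k)} \<Longrightarrow> path_sol l m > 0"
    and sum: "(\<Sum>k = 1..s. path_sol l (n k) / path_sol l (Suc (n k))) = l"
    using exists_positive_root[OF s n] by blast
  define y where "y = case_vertex 1 (\<lambda>k m. 1 / path_sol l (Suc (n k)) * path_sol l m)"
  have pos': "path_sol l (Suc (n k)) > 0" if "k \<in> {1..s}" for k
    using pos[OF that, of "Suc (n k)"] by simp
  have ev: "eigenvector ?A (vec_of_labelling vs y) l"
    unfolding y_def
  proof (rule starlike_eigenvector_of_coefficients[OF n vs])
    show "1 \<in> {1..s}" "1 / path_sol l (Suc (n 1)) \<noteq> 0"
      using s pos'[of 1] by auto
    show "1 = 1 / path_sol l (Suc (n k)) * path_sol l (Suc (n k))" if "k \<in> {1..s}" for k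
      using pos'[OF that] by simp
    show "(\<Sum>k = 1..s. 1 / path_sol l (Suc (n k)) * path_sol l (n k)) = l * 1"
      using sum by simp
  qed
  have ypos: "y v > 0" if "v \<in> set vs" for v
  proof (cases v)
    case (Branch k m)
    then have "k \<in> {1..s}" "m \<in> {1..n k}"
      using that by (auto simp: vs starlike_def)
    then show ?thesis
      using Branch pos[of k m] pos'[of k] by (simp add: y_def)
  qed (simp add: y_def)
  have "sym (parcs (starlike s n))"
    by (auto simp: sym_def starlike_def insert_commute)
  then have idx: "graph_index (starlike s n) vs = l"
    using graph_index_eqI[OF vs(1) _ ev ypos] by blast
  have "\<exists>c. z = c \<cdot>\<^sub>v vec_of_labelling vs y" if z: "eigenvector ?A z l" for z
  proof -
    have "z \<in> carrier_vec (length vs)"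
      using z by (simp add: eigenvector_def adjacency_matrix_def)
    then obtain w where w: "z = vec_of_labelling vs w"
      using vec_of_labelling_surj[OF vs(1)] by blast
    have "w v = w Center * y v" if v: "v \<in> set vs" for v
    proof (cases v)
      case (Branch k m)
      then have km: "k \<in> {1..s}" "m \<in> {1..n k}"
        using v by (auto simp: vs starlike_def)
      then obtain c where "w Center = c * path_sol l (Suc (n k))" "w v = c * path_sol l m"
        using z Branch unfolding w starlike_eigenvector_iff[OF n vs] by blast
      then show ?thesis
        using Branch pos'[OF km(1)] by (simp add: y_def)
    qed (simp add: y_def)
    then have "z = w Center \<cdot>\<^sub>v vec_of_labelling vs y"
      unfolding w vec_of_labelling_def by (intro eq_vecI) auto
    then show ?thesis ..
  qed
  then have "principal_eigenvector (starlike s n) vs y"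
    unfolding principal_eigenvector_def idx using ev ypos vs by blast
  then show thesis
    using that[of y] l pos sum unfolding idx by blast
qed

section \<open>Translation of the spectral statements into rho\<close>

theorem theorem1:
  fixes s :: nat and n :: "nat \<Rightarrow> nat" and G :: "vertex pair_pre_digraph" and vs :: "vertex list"
  assumes s: "s \<ge> 1"
    and n: "\<And>k. 1 \<le> k \<Longrightarrow> k \<le> s \<Longrightarrow> n k \<ge> 1"
    and G: "G = starlike s n"
    and vs: "distinct vs" "set vs = pverts G"
  shows
    "(\<forall>l \<in> positive_spectrum G vs. \<forall>t. t = l\<^sup>2 \<longrightarrow>
        ereal t = rho_sum t s n \<or>
        (\<exists>k \<in> {1..s}. \<exists>j \<in> {1..s}. k \<noteq> j \<and>
           ereal t = rho t (n k - 1) \<and> ereal t = rho t (n j - 1))) \<and>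
     (\<forall>t > 0.
        rho_sum t s n = ereal t \<or>
        (\<exists>k \<in> {1..s}. \<exists>j \<in> {1..s}. k \<noteq> j \<and>
           rho t (n k - 1) = ereal t \<and> rho t (n j - 1) = ereal t)
        \<longrightarrow> sqrt t \<in> positive_spectrum G vs) \<and>
     (\<exists>t_max > 0.
        rho_sum t_max s n = ereal t_max \<and>
        (\<forall>t > 0. rho_sum t s n = ereal t \<longrightarrow> t \<le> t_max) \<and>
        graph_index G vs = sqrt t_max) \<and>
     (\<forall>t. t = (graph_index G vs)\<^sup>2 \<longrightarrow>
        (\<exists>y. principal_eigenvector G vs y) \<and>
        (\<forall>y. principal_eigenvector G vs y \<longrightarrow>
           (\<exists>c :: real. c \<noteq> 0 \<and>
              y Center = c * sqrt t \<and>
              (\<forall>k \<in> {1..s}. \<forall>m \<in> {1..n k}.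
                 ereal (y (Branch k m)) =
                   ereal c * (ereal (t powr ((real m - real (n k)) / 2)) * (\<Prod>i = m..n k. rho t i))))))"
proof (intro conjI)
  let ?U = "path_sol"
  note vs' = vs[unfolded G]
  have n': "\<forall>k\<in>{1..s}. n k \<ge> 1"
    using n by simp
  note spec = starlike_spectrum_iff[OF s n' vs', folded G]
  \<comment> \<open>Truncated subtraction is harmless, as every branch has at least one
    vertex.\<close>
  have rho_pred: "rho (l\<^sup>2) (n k - 1) = ereal (l\<^sup>2) \<longleftrightarrow> ?U l (Suc (n k)) = 0"
    if "l > 0" "k \<in> {1..s}" for l k
  proof -
    have "Suc (Suc (n k - 1)) = Suc (n k)"
      using n[of k] that by simp
    then show ?thesis
      using rho_eq_iff[OF that(1), of "n k - 1"] by simp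
  qed
  have pos_spec: "l \<in> graph_spectrum G vs \<longleftrightarrow> rho_sum (l\<^sup>2) s n = ereal (l\<^sup>2) \<or>
      (\<exists>k \<in> {1..s}. \<exists>j \<in> {1..s}. k \<noteq> j \<and>
        rho (l\<^sup>2) (n k - 1) = ereal (l\<^sup>2) \<and> rho (l\<^sup>2) (n j - 1) = ereal (l\<^sup>2))"
    if "l > 0" for l
    unfolding spec rho_sum_eq_iff[OF that]
    by (intro arg_cong2[where f = "(\<or>)"] bex_cong refl) (simp only: rho_pred[OF that])
  show "\<forall>l \<in> positive_spectrum G vs. \<forall>t. t = l\<^sup>2 \<longrightarrow>
        ereal t = rho_sum t s n \<or>
        (\<exists>k \<in> {1..s}. \<exists>j \<in> {1..s}. k \<noteq> j \<and>
           ereal t = rho t (n k - 1) \<and> ereal t = rho t (n j - 1))"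
  proof (intro ballI allI impI)
    fix l t
    assume l: "l \<in> positive_spectrum G vs" and t: "t = l\<^sup>2"
    then have "rho_sum t s n = ereal t \<or>
        (\<exists>k \<in> {1..s}. \<exists>j \<in> {1..s}. k \<noteq> j \<and>
           rho t (n k - 1) = ereal t \<and> rho t (n j - 1) = ereal t)"
      using pos_spec[of l] by (simp add: positive_spectrum_def)
    then show "ereal t = rho_sum t s n \<or>
        (\<exists>k \<in> {1..s}. \<exists>j \<in> {1..s}. k \<noteq> j \<and>
           ereal t = rho t (n k - 1) \<and> ereal t = rho t (n j - 1))"
      by (simp only: eq_commute[of _ "ereal t"])
  qed
  show conv: "\<forall>t > 0.
        rho_sum t s n = ereal t \<or>
        (\<exists>k \<in> {1..s}. \<exists>j \<in> {1..s}. k \<noteq> j \<and>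
           rho t (n k - 1) = ereal t \<and> rho t (n j - 1) = ereal t)
        \<longrightarrow> sqrt t \<in> positive_spectrum G vs"
  proof (intro allI impI)
    fix t :: real
    assume t: "t > 0" and "rho_sum t s n = ereal t \<or>
        (\<exists>k \<in> {1..s}. \<exists>j \<in> {1..s}. k \<noteq> j \<and>
           rho t (n k - 1) = ereal t \<and> rho t (n j - 1) = ereal t)"
    then show "sqrt t \<in> positive_spectrum G vs"
      using pos_spec[of "sqrt t"] by (simp add: positive_spectrum_def)
  qed
  define r where "r = graph_index G vs"
  obtain y where r: "r > 0"
    and pos: "\<And>k m. k \<in> {1..s} \<Longrightarrow> m \<in> {1..Suc (n k)} \<Longrightarrow> ?U r m > 0"
    and sum: "(\<Sum>k = 1..s. ?U r (n k) / ?U r (Suc (n k))) = r"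
    and y: "principal_eigenvector G vs y"
    using starlike_index[OF s n' vs'] unfolding r_def G by blast
  have pos': "?U r (Suc (n k)) > 0" if "k \<in> {1..s}" for k
    using pos[OF that, of "Suc (n k)"] by simp
  show "\<exists>t_max > 0.
        rho_sum t_max s n = ereal t_max \<and>
        (\<forall>t > 0. rho_sum t s n = ereal t \<longrightarrow> t \<le> t_max) \<and>
        graph_index G vs = sqrt t_max"
  \<comment> \<open>The maximal root is the square of the index: the index satisfies the sum
    condition, and any other root t makes \<open>sqrt t\<close> an eigenvalue, hence at most
    r.\<close>
  proof (intro exI conjI allI impI)
    show "r\<^sup>2 > 0" "graph_index G vs = sqrt (r\<^sup>2)"
      using r by (auto simp: r_def)
    show "rho_sum (r\<^sup>2) s n = ereal (r\<^sup>2)"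
      unfolding rho_sum_eq_iff[OF r] using sum pos' by (metis less_irrefl)
    fix t :: real
    assume "t > 0" "rho_sum t s n = ereal t"
    then have "sqrt t \<in> graph_spectrum G vs"
      using conv unfolding positive_spectrum_def by blast
    moreover have "finite (graph_spectrum G vs)"
      unfolding graph_spectrum_def
      by (rule card_finite_spectrum[of _ "length vs"]) (simp add: adjacency_matrix_def)
    ultimately have "sqrt t \<le> r"
      unfolding r_def graph_index_def by (intro Max_ge)
    then show "t \<le> r\<^sup>2"
      by (rule sqrt_le_D)
  qed
  show "\<forall>t. t = (graph_index G vs)\<^sup>2 \<longrightarrow>
        (\<exists>y. principal_eigenvector G vs y) \<and>
        (\<forall>y. principal_eigenvector G vs y \<longrightarrow>
           (\<exists>c :: real. c \<noteq> 0 \<and>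
              y Center = c * sqrt t \<and>
              (\<forall>k \<in> {1..s}. \<forall>m \<in> {1..n k}.
                 ereal (y (Branch k m)) =
                   ereal c * (ereal (t powr ((real m - real (n k)) / 2)) * (\<Prod>i = m..n k. rho t i)))))"
    unfolding r_def[symmetric]
  proof (intro allI impI conjI)
    show "\<exists>y. principal_eigenvector G vs y"
      using y by blast
    fix t z assume t: "t = r\<^sup>2" and z: "principal_eigenvector G vs z"
    have z0: "z Center > 0"
      using z by (simp add: principal_eigenvector_def G starlike_def)
    have ev: "eigenvector (adjacency_matrix G vs) (vec_of_labelling vs z) r"
      using z by (simp add: principal_eigenvector_def r_def)
    show "\<exists>c :: real. c \<noteq> 0 \<and>
              z Center = c * sqrt t \<and>
              (\<forall>k \<in> {1..s}. \<forall>m \<in> {1..n k}.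
                 ereal (z (Branch k m)) =
                   ereal c * (ereal (t powr ((real m - real (n k)) / 2)) * (\<Prod>i = m..n k. rho t i)))"
    proof (intro exI conjI ballI)
      \<comment> \<open>The multiplier is fixed by the centre, where
        \<open>sqrt t = r\<close>.\<close>
      show "z Center / r \<noteq> 0" "z Center = z Center / r * sqrt t"
        using z0 r t by auto
      fix k m assume k: "k \<in> {1..s}" and m: "m \<in> {1..n k}"
      obtain c where c: "z Center = c * ?U r (Suc (n k))" "z (Branch k m) = c * ?U r m"
        using ev k m unfolding G starlike_eigenvector_iff[OF n' vs'] by blast
      \<comment> \<open>The power of t cancels all but one of the n k - m + 1 factors r of the
        telescoped product; the last one cancels against the multiplier
        \<open>z Center / r\<close>.\<close>
      have "t powr ((real m - real (n k)) / 2) = r powr (real m - real (n k))"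
        using r by (simp add: t powr_powr diff_divide_distrib flip: powr_numeral)
      also have "\<dots> = inverse (r ^ (n k - m))"
        using r m by (simp add: powr_diff powr_realpow power_diff field_simps)
      finally have "t powr ((real m - real (n k)) / 2) = inverse (r ^ (n k - m))" .
      moreover have "(\<Prod>i = m..n k. rho t i) =
          ereal (r ^ Suc (n k - m) * ?U r m / ?U r (Suc (n k)))"
        unfolding t using m pos[OF k] by (intro prod_rho_eq r) auto
      moreover have "z (Branch k m) = z Center / r * (inverse (r ^ (n k - m)) *
          (r ^ Suc (n k - m) * ?U r m / ?U r (Suc (n k))))"
        using r pos'[OF k] by (simp add: c field_simps del: path_sol.simps)
      ultimately show "ereal (z (Branch k m)) = ereal (z Center / r) *
          (ereal (t powr ((real m - real (n k)) / 2)) * (\<Prod>i = m..n k. rho t i))"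
        by simp
    qed
  qed
qed

end
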